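(* Let $x$ be a rational $\overline{\mathbb{E}}$-inner function with $x(\overline{\mathbb{D}})\not\subseteq\mathcal{R}_{\overline{\mathbb{E}}}$, and suppose that $x$ has $n$ royal nodes in $\overline{\mathbb D}$, $k$ of which are in $\mathbb{T}$ (royal nodes being counted with multiplicity $\#\sigma$). If $2k\le n$, then $x$ is not an extreme point of the set $\mathcal{J}$ of all rational $\overline{\mathbb{E}}$-inner functions.
   Context: $\mathbb{D}$ is the open unit disc and $\mathbb{T}$ the unit circle in $\mathbb{C}$. The open tetrablock is $\mathbb{E}=\{(x_1,x_2,x_3)\in\mathbb{C}^3: 1-x_1z-x_2w+x_3zw\neq 0 \text{ whenever } |z|\le 1,|w|\le 1\}$, with closure $\overline{\mathbb{E}}$. Its distinguished boundary is $b\overline{\mathbb{E}}=\{x\in\mathbb{C}^3: x_1=\overline{x_2}x_3,\ |x_3|=1,\ |x_2|\le 1\}$. A rational $\overline{\mathbb{E}}$-inner function is a rational analytic map $x=(x_1,x_2,x_3):\mathbb{D}\to\overline{\mathbb{E}}$ (automatically continuous on $\overline{\mathbb{D}}$) that maps $\mathbb{T}$ into $b\overline{\mathbb{E}}$. The degree of $x$ is the degree of the finite Blaschke product $x_3$. The royal variety is $\mathcal{R}_{\overline{\mathbb{E}}}=\{(x_1,x_2,x_3)\in\mathbb{C}^3:x_1x_2=x_3\}$. For a polynomial $f$ of degree at most $m$, $f^{\sim m}(\lambda)=\lambda^m\overline{f(1/\overline{\lambda})}$. A rational $\overline{\mathbb{E}}$-inner function $x$ of degree $m$ can be written $x=(E_1/D,E_2/D,D^{\sim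 m}/D)$ with polynomials $E_1,E_2,D$ of degree at most $m$, $D\ne0$ on $\overline{\mathbb{D}}$; these are unique up to a common nonzero real factor. The royal polynomial of $x$ is $R_x=D^{\sim m}D-E_1E_2$. Royal nodes of $x$ are the points $\sigma\in\overline{\mathbb{D}}$ with $x(\sigma)\in\mathcal{R}_{\overline{\mathbb{E}}}$, i.e. the zeros of $R_x$ in $\overline{\mathbb{D}}$. If $x(\overline{\mathbb{D}})\not\subseteq\mathcal{R}_{\overline{\mathbb{E}}}$ and $\sigma$ is a zero of $R_x$ of order $\ell$, then $\#\sigma=\ell$ if $\sigma\in\mathbb{D}$ and $\#\sigma=\ell/2$ if $\sigma\in\mathbb{T}$. A function $x\in\mathcal{J}$ is an extreme point of $\mathcal{J}$ if whenever $x=tx^1+(1-t)x^2$ with $t\in(0,1)$ and $x^1,x^2\in\mathcal{J}$, then $x^1=x^2$. *)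

theory Defs
  imports "HOL-Analysis.Analysis" "HOL-Computational_Algebra.Polynomial"
begin

type_synonym complex3 = "complex \<times> complex \<times> complex"

definition tetrablock :: "complex3 set" where
  "tetrablock = {(x1, x2, x3). \<forall>z w. norm z \<le> 1 \<longrightarrow> norm w \<le> 1 \<longrightarrow>
     1 - x1 * z - x2 * w + x3 * z * w \<noteq> 0}"

definition tetrablock_boundary :: "complex3 set" where
  "tetrablock_boundary = {(x1, x2, x3). x1 = cnj x2 * x3 \<and> norm x3 = 1 \<and> norm x2 \<le> 1}"

definition royal_variety :: "complex3 set" where
  "royal_variety = {(x1, x2, x3). x1 * x2 = x3}"

abbreviation comp1 :: "(complex \<Rightarrow> complex3) \<Rightarrow> complex \<Rightarrow> complex" where
  "comp1 x \<equiv> (\<lambda>\<zeta>. fst (x \<zeta>))"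
abbreviation comp2 :: "(complex \<Rightarrow> complex3) \<Rightarrow> complex \<Rightarrow> complex" where
  "comp2 x \<equiv> (\<lambda>\<zeta>. fst (snd (x \<zeta>)))"
abbreviation comp3 :: "(complex \<Rightarrow> complex3) \<Rightarrow> complex \<Rightarrow> complex" where
  "comp3 x \<equiv> (\<lambda>\<zeta>. snd (snd (x \<zeta>)))"

definition rational_analytic_on :: "complex set \<Rightarrow> (complex \<Rightarrow> complex) \<Rightarrow> bool" where
  "rational_analytic_on S f \<longleftrightarrow>
     (\<exists>p q. \<forall>\<zeta>\<in>S. poly q \<zeta> \<noteq> 0 \<and> f \<zeta> = poly p \<zeta> / poly q \<zeta>)"

text \<open>A rational inner function is a map on the open disc; its boundary values are those of its
  continuous extension to the closed disc.  Here the function already carries these values,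
  which is what the continuity condition expresses.  Values outside the closed disc are
  irrelevant, and functions are always compared on the disc only.\<close>

definition rational_tetra_inner :: "(complex \<Rightarrow> complex3) set" where
  "rational_tetra_inner = {x.
     rational_analytic_on (ball 0 1) (comp1 x) \<and>
     rational_analytic_on (ball 0 1) (comp2 x) \<and>
     rational_analytic_on (ball 0 1) (comp3 x) \<and>
     continuous_on (cball 0 1) x \<and>
     x ` ball 0 1 \<subseteq> closure tetrablock \<and>
     x ` sphere 0 1 \<subseteq> tetrablock_boundary}"

definition finite_Blaschke_product :: "nat \<Rightarrow> (complex \<Rightarrow> complex) \<Rightarrow> bool" where
  "finite_Blaschke_product m f \<longleftrightarrow>
     (\<exists>c as. norm c = 1 \<and> length as = m \<and> (\<forall>a\<in>set as. norm a < 1) \<and>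
       (\<forall>\<zeta>\<in>ball 0 1. f \<zeta> = c * (\<Prod>a\<leftarrow>as. (\<zeta> - a) / (1 - cnj a * \<zeta>))))"

text \<open>The degree of a rational inner function is that of the Blaschke product given by its third
  component.\<close>

definition has_inner_degree :: "(complex \<Rightarrow> complex3) \<Rightarrow> nat \<Rightarrow> bool" where
  "has_inner_degree x m \<longleftrightarrow> finite_Blaschke_product m (comp3 x)"

definition tilde_poly :: "nat \<Rightarrow> complex poly \<Rightarrow> complex poly" where
  "tilde_poly m f = (\<Sum>i\<le>m. monom (cnj (coeff f (m - i))) i)"

lemma poly_tilde_poly:
  assumes "degree f \<le> m" "\<zeta> \<noteq> 0"
  shows "poly (tilde_poly m f) \<zeta> = \<zeta> ^ m * cnj (poly f (1 / cnj \<zeta>))"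
proof -
  have f: "poly f w = (\<Sum>i\<le>m. coeff f i * w ^ i)" for w
    unfolding poly_altdef using assms(1)
    by (intro sum.mono_neutral_left) (auto simp: coeff_eq_0)
  have "poly (tilde_poly m f) \<zeta> = (\<Sum>i\<le>m. cnj (coeff f (m - i)) * \<zeta> ^ i)"
    by (simp add: tilde_poly_def poly_sum poly_monom)
  also have "\<dots> = (\<Sum>i\<le>m. cnj (coeff f i) * \<zeta> ^ (m - i))"
    by (rule sum.reindex_bij_witness[of _ "\<lambda>i. m - i" "\<lambda>i. m - i"]) auto
  also have "\<dots> = (\<Sum>i\<le>m. \<zeta> ^ m * (cnj (coeff f i) * (1 / \<zeta>) ^ i))"
    using assms(2) by (intro sum.cong) (auto simp: power_diff power_divide)
  also have "\<dots> = \<zeta> ^ m * cnj (poly f (1 / cnj \<zeta>))"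
    by (simp add: f sum_distrib_left)
  finally show ?thesis .
qed

definition tetra_representation ::
    "(complex \<Rightarrow> complex3) \<Rightarrow> nat \<Rightarrow> complex poly \<Rightarrow> complex poly \<Rightarrow> complex poly \<Rightarrow> bool" where
  "tetra_representation x m E1 E2 D \<longleftrightarrow>
     has_inner_degree x m \<and> degree E1 \<le> m \<and> degree E2 \<le> m \<and> degree D \<le> m \<and>
     (\<forall>\<zeta>\<in>cball 0 1. poly D \<zeta> \<noteq> 0 \<and>
        x \<zeta> = (poly E1 \<zeta> / poly D \<zeta>, poly E2 \<zeta> / poly D \<zeta>,
               poly (tilde_poly m D) \<zeta> / poly D \<zeta>))"

text \<open>The representation is unique up to a common nonzero real factor, so the chosen polynomial is
  determined up to a positive factor and its zeros and their orders do not depend on the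
  choice.\<close>

definition royal_poly :: "(complex \<Rightarrow> complex3) \<Rightarrow> complex poly" where
  "royal_poly x =
     (SOME R. \<exists>m E1 E2 D. tetra_representation x m E1 E2 D \<and> R = tilde_poly m D * D - E1 * E2)"

definition royal_nodes :: "(complex \<Rightarrow> complex3) \<Rightarrow> complex set" where
  "royal_nodes x = {\<sigma>\<in>cball 0 1. x \<sigma> \<in> royal_variety}"

definition royal_multiplicity :: "(complex \<Rightarrow> complex3) \<Rightarrow> complex \<Rightarrow> real" where
  "royal_multiplicity x \<sigma> =
     (if norm \<sigma> < 1 then real (order \<sigma> (royal_poly x)) else real (order \<sigma> (royal_poly x)) / 2)"

definition extreme_point_on ::
    "'a set \<Rightarrow> ('a \<Rightarrow> 'b::real_vector) set \<Rightarrow> ('a \<Rightarrow> 'b) \<Rightarrow> bool" where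
  "extreme_point_on S J x \<longleftrightarrow> x \<in> J \<and>
     (\<forall>y\<in>J. \<forall>z\<in>J. \<forall>t. 0 < t \<longrightarrow> t < 1 \<longrightarrow>
        (\<forall>\<zeta>\<in>S. x \<zeta> = t *\<^sub>R y \<zeta> + (1 - t) *\<^sub>R z \<zeta>) \<longrightarrow> (\<forall>\<zeta>\<in>S. y \<zeta> = z \<zeta>))"

end

theory Submission
  imports Defs "HOL-Complex_Analysis.Complex_Analysis"
    "HOL-Computational_Algebra.Fundamental_Theorem_Algebra"
begin

text \<open>Write \<open>x = (E1/D, E2/D, D'/D)\<close>, where \<open>f'\<close> denotes the reflection of a polynomial \<open>f\<close> in the
  unit circle with respect to the degree \<open>m\<close> of \<open>x\<close>. On the circle \<open>f'(\<zeta>) = \<zeta>\<^sup>m cnj (f(\<zeta>))\<close>, so that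
  \<open>x\<close> maps the circle into the distinguished boundary exactly if \<open>E1 = E2'\<close> and \<open>|E2| \<le> |D|\<close> there.
  By the maximum principle nothing else is required: every polynomial \<open>E\<close> of degree at
  most \<open>m\<close> with \<open>|E| \<le> |D|\<close> on the circle gives an inner function \<open>(E'/D, E/D, D'/D)\<close>
  (\<open>rational_tetra_inner_if_dominated\<close>). Hence \<open>x\<close> is the midpoint of two different inner functions
  as soon as there is a polynomial \<open>g \<noteq> 0\<close> of degree at most \<open>m\<close> and an \<open>\<epsilon> > 0\<close> with
  \<open>|E2 \<plusminus> \<epsilon> g| \<le> |D|\<close> on the circle.

  The room for such a perturbation is measured by the royal polynomial \<open>R\<close>, because
  \<open>|R| = |D|\<^sup>2 - |E2|\<^sup>2\<close> on the circle. Let \<open>g\<close> be the monic polynomial whose zeros are the zeros of \<open>R\<close>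
  on the circle, with the same orders. Then \<open>|R| = |g| |h|\<close> with \<open>h\<close> free of zeros on the circle, while
  \<open>|E2 \<plusminus> \<epsilon> g|\<^sup>2 \<le> |E2|\<^sup>2 + \<epsilon> |g| (2 |E2| + \<epsilon> |g|)\<close>, so that a small \<open>\<epsilon>\<close> will do.

  It remains to see that \<open>g\<close>, which has degree \<open>2k\<close>, has degree at most \<open>m\<close>. As \<open>R\<close> is its own
  reflection with respect to the degree \<open>2m\<close>, its zeros in the open disc are paired with zeros outside
  the closed disc or at infinity, which gives \<open>2(n - k) + 2k \<le> 2m\<close>
  (\<open>self_reflected_root_count\<close>), and therefore \<open>2k \<le> n \<le> m\<close>.

  The royal polynomial is given by a choice among all polynomial representations of \<open>x\<close>, so that the
  argument also needs the existence of one (\<open>tetra_representation_exists\<close>). It comes from a common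
  denominator of the three components in lowest terms.\<close>

section \<open>Reflected polynomials\<close>

lemma coeff_tilde_poly: "coeff (tilde_poly m f) i = (if i \<le> m then cnj (coeff f (m - i)) else 0)"
  by (simp add: tilde_poly_def coeff_sum sum.delta)

lemma degree_tilde_poly_le: "degree (tilde_poly m f) \<le> m"
  by (intro degree_le) (simp add: coeff_tilde_poly)

lemma tilde_poly_add: "tilde_poly m (f + g) = tilde_poly m f + tilde_poly m g"
  by (simp add: poly_eq_iff coeff_tilde_poly)

lemma tilde_poly_diff: "tilde_poly m (f - g) = tilde_poly m f - tilde_poly m g"
  by (simp add: poly_eq_iff coeff_tilde_poly)

lemma tilde_poly_smult: "tilde_poly m (smult c f) = smult (cnj c) (tilde_poly m f)"
  by (simp add: poly_eq_iff coeff_tilde_poly)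

lemma poly_tilde_poly_0: "poly (tilde_poly m f) 0 = cnj (coeff f m)"
  by (simp add: poly_0_coeff_0 coeff_tilde_poly)

lemma poly_tilde_poly_circle:
  assumes "degree f \<le> m" "norm \<zeta> = 1"
  shows "poly (tilde_poly m f) \<zeta> = \<zeta> ^ m * cnj (poly f \<zeta>)"
proof -
  have "\<zeta> \<noteq> 0" using assms(2) by auto
  moreover have "1 / cnj \<zeta> = \<zeta>"
    using assms(2) complex_norm_square[of \<zeta>] \<open>\<zeta> \<noteq> 0\<close> by (simp add: field_simps)
  ultimately show ?thesis using poly_tilde_poly[OF assms(1)] by metis
qed

lemma mult_cnj_circle: "norm (\<zeta>::complex) = 1 \<Longrightarrow> \<zeta> * cnj \<zeta> = 1"
  using complex_norm_square[of \<zeta>] by simp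

lemma poly_eq_on_circle:
  fixes p q :: "complex poly"
  assumes "\<And>\<zeta>. norm \<zeta> = 1 \<Longrightarrow> poly p \<zeta> = poly q \<zeta>"
  shows "p = q"
proof (rule ccontr)
  assume "p \<noteq> q"
  then have "finite {\<zeta>. poly (p - q) \<zeta> = 0}" by (intro poly_roots_finite) simp
  moreover have "sphere 0 1 \<subseteq> {\<zeta>. poly (p - q) \<zeta> = 0}" using assms by auto
  moreover have "infinite (sphere (0::complex) 1)"
    by (intro uncountable_infinite connected_uncountable[of _ 1 "-1"] connected_sphere) auto
  ultimately show False using finite_subset by blast
qed

lemma tilde_poly_tilde_poly: "degree f \<le> m \<Longrightarrow> tilde_poly m (tilde_poly m f) = f"
  by (intro poly_eqI) (auto simp: coeff_tilde_poly coeff_eq_0)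

lemma tilde_poly_root_in_disc:
  assumes "degree f \<le> m" "\<And>\<zeta>. norm \<zeta> \<le> 1 \<Longrightarrow> poly f \<zeta> \<noteq> 0" "poly (tilde_poly m f) a = 0"
  shows "norm a < 1"
proof (rule ccontr)
  assume a: "\<not> norm a < 1"
  then have "a \<noteq> 0" by auto
  moreover have "norm (1 / cnj a) \<le> 1" using a by (simp add: norm_divide divide_le_eq)
  ultimately show False
    using assms(2)[of "1 / cnj a"] assms(3) poly_tilde_poly[OF assms(1), of a] by simp
qed

text \<open>If \<open>g\<close> had degree \<open>d > m\<close>, then \<open>\<zeta> ^ (d - m) f(\<zeta>)\<close> would be the reflection of \<open>g\<close> with respect to
  \<open>d\<close>; but the former vanishes at 0, where the latter is the conjugate of the leading coefficient.\<close>

lemma degree_le_if_reflected_on_circle: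
  fixes f g :: "complex poly"
  assumes "\<And>\<zeta>. norm \<zeta> = 1 \<Longrightarrow> poly f \<zeta> = \<zeta> ^ m * cnj (poly g \<zeta>)"
  shows "degree g \<le> m"
proof (rule ccontr)
  assume *: "\<not> degree g \<le> m"
  have "monom 1 (degree g - m) * f = tilde_poly (degree g) g"
  proof (rule poly_eq_on_circle)
    fix \<zeta> :: complex assume "norm \<zeta> = 1"
    then show "poly (monom 1 (degree g - m) * f) \<zeta> = poly (tilde_poly (degree g) g) \<zeta>"
      using * assms by (simp add: poly_monom poly_tilde_poly_circle flip: power_add mult.assoc)
  qed
  then have "poly (monom 1 (degree g - m) * f) 0 = cnj (lead_coeff g)"
    by (simp add: poly_tilde_poly_0)
  with * have "g = 0" by (simp add: poly_monom zero_power)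
  with * show False by simp
qed

text \<open>Polynomials without a common complex root are coprime; splitting off the roots of \<open>p\<close> one
  at a time turns this into a comparison of orders.\<close>

lemma dvd_mult_left_if_no_common_root:
  fixes p q r :: "complex poly"
  assumes "p dvd q * r" "\<And>b. poly p b = 0 \<Longrightarrow> poly q b \<noteq> 0"
  shows "p dvd r"
  using assms
proof (induction p rule: poly_root_order_induct)
  case (no_roots p)
  then have "degree p = 0"
    using fundamental_theorem_of_algebra constant_degree by blast
  moreover have "p \<noteq> 0" using no_roots(1)[of 0] by auto
  ultimately show ?case using is_unit_iff_degree unit_imp_dvd by blast
next
  case (root p a n)
  have p0: "p \<noteq> 0" using root.hyps by auto
  have q: "poly q a \<noteq> 0" using root.prems(2)[of a] root.hyps(1) by simp
  have "p dvd q * r" using root.prems(1) dvd_mult_right by blast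
  then obtain s where s: "r = p * s"
    using root.IH root.prems(2) by (auto elim: dvdE)
  have "p * [:-a, 1:] ^ n dvd p * (q * s)" using root.prems(1) by (simp add: s mult_ac)
  then have *: "[:-a, 1:] ^ n dvd q * s" using p0 by (simp only: dvd_mult_cancel_left) simp
  have "[:-a, 1:] ^ n dvd s"
  proof (cases "s = 0")
    case False
    moreover have "q \<noteq> 0" using q by auto
    ultimately have "order a (q * s) = order a s" "q * s \<noteq> 0"
      using q by (auto simp: order_mult order_0I)
    then show ?thesis using * by (simp add: order_divides)
  qed simp
  then show ?case unfolding s by (metis mult.commute mult_dvd_mono dvd_refl)
qed (metis dvd_0_left_iff mult_eq_0_iff poly_0)

section \<open>Inner functions given by polynomials\<close>

text \<open>The points \<open>(ra, rb, r\<^sup>2c)\<close> with \<open>r < 1\<close> lie in the tetrablock, since \<open>r\<close> can be moved into \<open>z\<close> and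
  \<open>w\<close>, and they tend to \<open>(a, b, c)\<close>.\<close>

lemma tetrablock_closureI:
  assumes "\<And>z w. norm z < 1 \<Longrightarrow> norm w < 1 \<Longrightarrow> 1 - a * z - b * w + c * z * w \<noteq> 0"
  shows "(a, b, c) \<in> closure tetrablock"
proof -
  let ?r = "\<lambda>n. of_real (1 - 1 / real (Suc n)) :: complex"
  have r: "norm (?r n) < 1" for n unfolding norm_of_real by simp
  have r1: "?r \<longlonglongrightarrow> of_real 1"
    by (intro tendsto_of_real) (use tendsto_diff[OF tendsto_const LIMSEQ_inverse_real_of_nat, of 1] in
        \<open>simp add: inverse_eq_divide\<close>)
  have "(?r n * a, ?r n * b, ?r n * ?r n * c) \<in> tetrablock" for n
    unfolding tetrablock_def
  proof (clarify)
    fix z w :: complex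
    assume zw: "norm z \<le> 1" "norm w \<le> 1" and
      0: "1 - ?r n * a * z - ?r n * b * w + ?r n * ?r n * c * z * w = 0"
    have "norm (?r n * v) < 1" if "norm v \<le> 1" for v
      using mult_right_le_one_le[of "norm (?r n)" "norm v"] that r[of n]
      unfolding norm_mult by simp
    from assms[OF this[OF zw(1)] this[OF zw(2)]] 0 show False by (simp only: mult_ac)
  qed
  moreover have "(\<lambda>n. (?r n * a, ?r n * b, ?r n * ?r n * c)) \<longlonglongrightarrow>
      (of_real 1 * a, of_real 1 * b, of_real 1 * of_real 1 * c)"
    by (intro tendsto_intros r1)
  ultimately show ?thesis
    unfolding closure_sequential by (intro exI[of _ "\<lambda>n. (?r n * a, ?r n * b, ?r n * ?r n * c)"]) simp
qed

text \<open>For fixed \<open>w\<close> in the disc, the quotient \<open>(f1 - f3 w) / (1 - f2 w)\<close> is analytic, and on the circle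
  its modulus is that of \<open>(cnj f2 - w) / (1 - f2 w)\<close>, which is at most 1. By the maximum principle
  it is at most 1 in the disc, and there its product with \<open>z\<close> cannot be 1.\<close>

lemma mem_closure_tetrablock_if_boundary:
  fixes f1 f2 f3 :: "complex \<Rightarrow> complex"
  assumes hol: "f1 holomorphic_on ball 0 1" "f2 holomorphic_on ball 0 1" "f3 holomorphic_on ball 0 1"
    and cont: "continuous_on (cball 0 1) f1" "continuous_on (cball 0 1) f2" "continuous_on (cball 0 1) f3"
    and bd: "\<And>\<zeta>. norm \<zeta> = 1 \<Longrightarrow> (f1 \<zeta>, f2 \<zeta>, f3 \<zeta>) \<in> tetrablock_boundary"
    and z: "\<zeta> \<in> ball 0 1"
  shows "(f1 \<zeta>, f2 \<zeta>, f3 \<zeta>) \<in> closure tetrablock"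
proof (rule tetrablock_closureI)
  fix z w :: complex assume zw: "norm z < 1" "norm w < 1"
  have f2: "norm (f2 \<xi>) \<le> 1" if "\<xi> \<in> cball 0 1" for \<xi>
    by (rule maximum_modulus_frontier[of f2 "cball 0 1"])
       (use hol cont bd that in \<open>auto simp: tetrablock_boundary_def\<close>)
  have ne: "1 - f2 \<xi> * w \<noteq> 0" if "\<xi> \<in> cball 0 1" for \<xi>
  proof
    assume "1 - f2 \<xi> * w = 0"
    then have "norm (f2 \<xi>) * norm w = 1" by (simp flip: norm_mult)
    then show False using f2[OF that] zw(2) by (smt (verit) mult_left_le_one_le norm_ge_zero)
  qed
  let ?\<Psi> = "\<lambda>\<xi>. (f1 \<xi> - f3 \<xi> * w) / (1 - f2 \<xi> * w)"
  have "norm (?\<Psi> \<zeta>) \<le> 1"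
  proof (rule maximum_modulus_frontier[of ?\<Psi> "cball 0 1"])
    show "?\<Psi> holomorphic_on interior (cball 0 1)"
      using ne by (auto intro!: holomorphic_intros hol)
    show "continuous_on (closure (cball 0 1)) ?\<Psi>"
      using ne by (auto intro!: continuous_intros cont)
    show "norm (?\<Psi> \<xi>) \<le> 1" if "\<xi> \<in> frontier (cball 0 1)" for \<xi>
    proof -
      have x: "norm \<xi> = 1" using that by simp
      have e: "f1 \<xi> = cnj (f2 \<xi>) * f3 \<xi>" "norm (f3 \<xi>) = 1" "norm (f2 \<xi>) \<le> 1"
        using bd[OF x] by (auto simp: tetrablock_boundary_def)
      have "norm (f1 \<xi> - f3 \<xi> * w) = norm (f3 \<xi> * (cnj (f2 \<xi>) - w))"
        by (simp add: e algebra_simps)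
      also have "\<dots> = norm (cnj (f2 \<xi>) - w)" by (simp add: norm_mult e)
      also have "\<dots> \<le> norm (1 - f2 \<xi> * w)"
      proof -
        have "(norm (1 - f2 \<xi> * w))\<^sup>2 - (norm (cnj (f2 \<xi>) - w))\<^sup>2
            = (1 - (norm (f2 \<xi>))\<^sup>2) * (1 - (norm w)\<^sup>2)"
          unfolding cmod_power2 by (simp add: algebra_simps power2_eq_square)
        moreover have "\<dots> \<ge> 0"
          using e(3) zw(2) by (intro mult_nonneg_nonneg) (auto simp: power_le_one)
        ultimately have "(norm (cnj (f2 \<xi>) - w))\<^sup>2 \<le> (norm (1 - f2 \<xi> * w))\<^sup>2" by linarith
        then show ?thesis by (rule power2_le_imp_le) (rule norm_ge_zero)
      qed
      finally show ?thesis using ne[of \<xi>] x by (simp add: norm_divide divide_le_eq)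
    qed
  qed (use z in auto)
  moreover have nz: "1 - f2 \<zeta> * w \<noteq> 0" using ne z by auto
  ultimately have "norm (?\<Psi> \<zeta> * z) < 1"
    using zw(1) unfolding norm_mult by (smt (verit) mult_left_le_one_le norm_ge_zero)
  then have "?\<Psi> \<zeta> * z \<noteq> 1" by auto
  then show "1 - f1 \<zeta> * z - f2 \<zeta> * w + f3 \<zeta> * z * w \<noteq> 0"
    using nz by (auto simp: field_simps)
qed

lemma rational_tetra_inner_if_dominated:
  assumes D: "degree D \<le> m" "\<And>\<zeta>. norm \<zeta> \<le> 1 \<Longrightarrow> poly D \<zeta> \<noteq> 0"
    and E: "degree E \<le> m" "\<And>\<zeta>. norm \<zeta> = 1 \<Longrightarrow> norm (poly E \<zeta>) \<le> norm (poly D \<zeta>)"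
  shows "(\<lambda>\<zeta>. (poly (tilde_poly m E) \<zeta> / poly D \<zeta>, poly E \<zeta> / poly D \<zeta>,
            poly (tilde_poly m D) \<zeta> / poly D \<zeta>)) \<in> rational_tetra_inner"
proof -
  let ?f1 = "\<lambda>\<zeta>. poly (tilde_poly m E) \<zeta> / poly D \<zeta>" and ?f2 = "\<lambda>\<zeta>. poly E \<zeta> / poly D \<zeta>"
    and ?f3 = "\<lambda>\<zeta>. poly (tilde_poly m D) \<zeta> / poly D \<zeta>"
  have hol: "(\<lambda>\<zeta>. poly f \<zeta> / poly D \<zeta>) holomorphic_on ball 0 1" for f
    using D(2) by (intro holomorphic_intros) auto
  have cont: "continuous_on (cball 0 1) (\<lambda>\<zeta>. poly f \<zeta> / poly D \<zeta>)" for f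
    using D(2) by (intro continuous_intros) auto
  have rat: "rational_analytic_on (ball 0 1) (\<lambda>\<zeta>. poly f \<zeta> / poly D \<zeta>)" for f
    unfolding rational_analytic_on_def using D(2) by (intro exI[of _ f] exI[of _ D]) auto
  have bd: "(?f1 \<zeta>, ?f2 \<zeta>, ?f3 \<zeta>) \<in> tetrablock_boundary" if "norm \<zeta> = 1" for \<zeta>
    using that D E by (auto simp: tetrablock_boundary_def poly_tilde_poly_circle norm_divide
        norm_mult norm_power divide_le_eq field_simps)
  show ?thesis
    unfolding rational_tetra_inner_def mem_Collect_eq fst_conv snd_conv
  proof (intro conjI rat)
    show "continuous_on (cball 0 1) (\<lambda>\<zeta>. (?f1 \<zeta>, ?f2 \<zeta>, ?f3 \<zeta>))"
      by (intro continuous_on_Pair cont)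
    show "(\<lambda>\<zeta>. (?f1 \<zeta>, ?f2 \<zeta>, ?f3 \<zeta>)) ` ball 0 1 \<subseteq> closure tetrablock"
      using mem_closure_tetrablock_if_boundary[OF hol hol hol cont cont cont bd] by blast
    show "(\<lambda>\<zeta>. (?f1 \<zeta>, ?f2 \<zeta>, ?f3 \<zeta>)) ` sphere 0 1 \<subseteq> tetrablock_boundary"
      using bd by (simp add: image_subset_iff)
  qed
qed

section \<open>Existence of the polynomial representation\<close>

lemma poly_prod_list_map: "poly (\<Prod>a\<leftarrow>as. f a) z = (\<Prod>a\<leftarrow>as. poly (f a) z)"
  by (induction as) auto

text \<open>Since \<open>D\<close> does not vanish at 0, its reflection has degree exactly \<open>m\<close>, and all its \<open>m\<close> zeros \<open>a\<close>
  lie in the disc. Reflecting the factors \<open>\<zeta> - a\<close> back expresses \<open>D\<close> by the factors \<open>1 - cnj a * \<zeta>\<close>.\<close>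

lemma finite_Blaschke_product_tilde_quotient:
  assumes D: "degree D \<le> m" "\<And>\<zeta>. norm \<zeta> \<le> 1 \<Longrightarrow> poly D \<zeta> \<noteq> 0"
    and f: "\<And>\<zeta>. norm \<zeta> < 1 \<Longrightarrow> f \<zeta> = poly (tilde_poly m D) \<zeta> / poly D \<zeta>"
  shows "finite_Blaschke_product m f"
proof -
  let ?T = "tilde_poly m D"
  define l where "l = lead_coeff ?T"
  have "coeff ?T m \<noteq> 0" using D(2)[of 0] by (simp add: coeff_tilde_poly poly_0_coeff_0)
  then have deg: "degree ?T = m" and l: "l \<noteq> 0"
    using degree_tilde_poly_le[of m D] le_degree[of ?T m] by (auto simp: l_def)
  obtain as where as: "mset as = proots ?T" using ex_mset by blast
  have T: "?T = smult l (\<Prod>a\<leftarrow>as. [:-a, 1:])"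
    using complex_poly_decompose_multiset[of ?T] prod_mset_prod_list[of "map (\<lambda>a. [:-a, 1:]) as"]
    by (simp add: l_def flip: as)
  have len: "length as = m"
    using size_proots_complex[of ?T] deg as by (metis size_mset)
  have norm_as: "norm a < 1" if "a \<in> set as" for a
  proof (rule tilde_poly_root_in_disc[OF D])
    have "a \<in> set_mset (proots ?T)" using that by (metis as set_mset_mset)
    then show "poly ?T a = 0" using l l_def by (subst (asm) set_count_proots) auto
  qed
  have "D = smult (cnj l) (\<Prod>a\<leftarrow>as. [:1, - cnj a:])"
  proof (rule poly_eq_on_circle)
    fix \<zeta> :: complex assume z: "norm \<zeta> = 1"
    have "poly D \<zeta> = \<zeta> ^ m * cnj (poly ?T \<zeta>)"
      using poly_tilde_poly_circle[OF degree_tilde_poly_le[of m D] z] tilde_poly_tilde_poly[OF D(1)]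
      by simp
    also have "\<dots> = cnj l * (\<zeta> ^ length as * cnj (\<Prod>a\<leftarrow>as. \<zeta> - a))"
      by (subst T) (simp add: poly_prod_list_map len mult_ac)
    also have "\<zeta> ^ length as * cnj (\<Prod>a\<leftarrow>as. \<zeta> - a) = (\<Prod>a\<leftarrow>as. 1 - cnj a * \<zeta>)"
    proof (induction as)
      case (Cons a as)
      have "\<zeta> * cnj (\<zeta> - a) = 1 - cnj a * \<zeta>"
        using mult_cnj_circle[OF z] by (simp add: algebra_simps)
      with Cons show ?case by (simp add: mult_ac)
    qed simp
    finally show "poly D \<zeta> = poly (smult (cnj l) (\<Prod>a\<leftarrow>as. [:1, - cnj a:])) \<zeta>"
      by (simp add: poly_prod_list_map mult_ac)
  qed
  then have "f \<zeta> = l / cnj l * (\<Prod>a\<leftarrow>as. (\<zeta> - a) / (1 - cnj a * \<zeta>))" if "norm \<zeta> < 1" for \<zeta>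
  proof -
    have div: "(\<Prod>a\<leftarrow>as. (\<zeta> - a) / (1 - cnj a * \<zeta>)) =
        (\<Prod>a\<leftarrow>as. \<zeta> - a) / (\<Prod>a\<leftarrow>as. 1 - cnj a * \<zeta>)"
      by (induction as) auto
    have "poly ?T \<zeta> = l * (\<Prod>a\<leftarrow>as. \<zeta> - a)"
      by (subst T) (simp add: poly_prod_list_map)
    moreover have "poly D \<zeta> = cnj l * (\<Prod>a\<leftarrow>as. 1 - cnj a * \<zeta>)"
      by (subst \<open>D = _\<close>) (simp add: poly_prod_list_map mult_ac)
    ultimately show ?thesis using f[OF that] by (simp add: div)
  qed
  then show ?thesis
    unfolding finite_Blaschke_product_def
    by (intro exI[of _ "l / cnj l"] exI[of _ as]) (use l len norm_as in \<open>auto simp: norm_divide\<close>)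
qed

text \<open>A common denominator of least degree does the job: a common root \<open>b\<close> lies outside the open disc,
  where the denominator has no zeros, and could be cancelled. Zeros of the denominator on the circle are
  excluded as well, since by continuity they would be common roots.\<close>

lemma reduced_common_denominator:
  assumes rat: "rational_analytic_on (ball 0 1) f1" "rational_analytic_on (ball 0 1) f2"
      "rational_analytic_on (ball 0 1) f3"
    and cont: "continuous_on (cball 0 1) f1" "continuous_on (cball 0 1) f2" "continuous_on (cball 0 1) f3"
  shows "\<exists>q p1 p2 p3.
    (\<forall>\<zeta>. norm \<zeta> \<le> 1 \<longrightarrow> poly q \<zeta> \<noteq> 0 \<and> poly p1 \<zeta> = poly q \<zeta> * f1 \<zeta> \<and>
        poly p2 \<zeta> = poly q \<zeta> * f2 \<zeta> \<and> poly p3 \<zeta> = poly q \<zeta> * f3 \<zeta>) \<and>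
    (\<forall>b. \<not> (poly q b = 0 \<and> poly p1 b = 0 \<and> poly p2 b = 0 \<and> poly p3 b = 0))"
proof -
  define P where "P = (\<lambda>(q, p1, p2, p3). \<forall>\<zeta>. norm \<zeta> < 1 \<longrightarrow> poly q \<zeta> \<noteq> 0 \<and>
    poly p1 \<zeta> = poly q \<zeta> * f1 \<zeta> \<and> poly p2 \<zeta> = poly q \<zeta> * f2 \<zeta> \<and> poly p3 \<zeta> = poly q \<zeta> * f3 \<zeta>)"
  obtain p1 q1 p2 q2 p3 q3 where
    "\<forall>\<zeta>\<in>ball 0 1. poly q1 \<zeta> \<noteq> 0 \<and> f1 \<zeta> = poly p1 \<zeta> / poly q1 \<zeta>"
    "\<forall>\<zeta>\<in>ball 0 1. poly q2 \<zeta> \<noteq> 0 \<and> f2 \<zeta> = poly p2 \<zeta> / poly q2 \<zeta>"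
    "\<forall>\<zeta>\<in>ball 0 1. poly q3 \<zeta> \<noteq> 0 \<and> f3 \<zeta> = poly p3 \<zeta> / poly q3 \<zeta>"
    using rat unfolding rational_analytic_on_def by metis
  then have "P (q1 * q2 * q3, p1 * q2 * q3, p2 * q1 * q3, p3 * q1 * q2)"
    unfolding P_def by auto
  from ex_has_least_nat[of P, OF this, of "\<lambda>t. degree (fst t)"]
  obtain t where t: "P t" "\<And>t'. P t' \<Longrightarrow> degree (fst t) \<le> degree (fst t')" by blast
  obtain q p1 p2 p3 where tq: "t = (q, p1, p2, p3)" by (cases t)
  have Pq: "P (q, p1, p2, p3)" using t(1) tq by simp
  have min: "degree q \<le> degree q'" if "P (q', p1', p2', p3')" for q' p1' p2' p3'
    using t(2)[OF that] tq by simp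
  have q0: "q \<noteq> 0" using Pq unfolding P_def by (auto dest: spec[of _ 0])
  have nocommon: False if root: "poly q b = 0" "poly p1 b = 0" "poly p2 b = 0" "poly p3 b = 0" for b
  proof -
    obtain q' p1' p2' p3' where e: "q = [:-b, 1:] * q'" "p1 = [:-b, 1:] * p1'"
      "p2 = [:-b, 1:] * p2'" "p3 = [:-b, 1:] * p3'"
      using root unfolding poly_eq_0_iff_dvd dvd_def by blast
    have "norm b \<ge> 1" using Pq root(1) unfolding P_def by (auto simp: not_less[symmetric])
    then have cancel: "poly p' \<zeta> = poly q' \<zeta> * f \<zeta>"
      if "norm \<zeta> < 1" "poly ([:-b, 1:] * p') \<zeta> = poly ([:-b, 1:] * q') \<zeta> * f \<zeta>" for \<zeta> f p'
    proof -
      have "(\<zeta> - b) * poly p' \<zeta> = (\<zeta> - b) * (poly q' \<zeta> * f \<zeta>)"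
        using that(2) by (simp add: algebra_simps)
      moreover have "\<zeta> - b \<noteq> 0" using that(1) \<open>norm b \<ge> 1\<close> by auto
      ultimately show ?thesis by (metis mult_left_cancel)
    qed
    have "P (q', p1', p2', p3')"
      unfolding P_def prod.case
    proof (intro allI impI conjI)
      fix \<zeta> :: complex assume z: "norm \<zeta> < 1"
      have *: "poly q \<zeta> \<noteq> 0" "poly p1 \<zeta> = poly q \<zeta> * f1 \<zeta>" "poly p2 \<zeta> = poly q \<zeta> * f2 \<zeta>"
        "poly p3 \<zeta> = poly q \<zeta> * f3 \<zeta>"
        using Pq z by (auto simp: P_def)
      show "poly q' \<zeta> \<noteq> 0" using *(1) by (auto simp: e)
      show "poly p1' \<zeta> = poly q' \<zeta> * f1 \<zeta>" "poly p2' \<zeta> = poly q' \<zeta> * f2 \<zeta>"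
        "poly p3' \<zeta> = poly q' \<zeta> * f3 \<zeta>"
        using *(2-) unfolding e by (auto intro!: cancel[OF z])
    qed
    from min[OF this] have "degree q \<le> degree q'" .
    moreover have "degree q = Suc (degree q')"
      using q0 unfolding e(1) by (subst degree_mult_eq) auto
    ultimately show False by simp
  qed
  have ext: "poly p \<zeta> = poly q \<zeta> * f \<zeta>"
    if "norm \<zeta> \<le> 1" "continuous_on (cball 0 1) f" "\<And>\<zeta>. norm \<zeta> < 1 \<Longrightarrow> poly p \<zeta> = poly q \<zeta> * f \<zeta>"
    for p f \<zeta>
  proof -
    have "poly p \<zeta> - poly q \<zeta> * f \<zeta> = 0"
      by (rule continuous_constant_on_closure[where S = "ball 0 1" and f = "\<lambda>\<zeta>. poly p \<zeta> - poly q \<zeta> * f \<zeta>"])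
         (use that in \<open>auto intro!: continuous_intros\<close>)
    then show ?thesis by simp
  qed
  have main: "poly p1 \<zeta> = poly q \<zeta> * f1 \<zeta> \<and> poly p2 \<zeta> = poly q \<zeta> * f2 \<zeta> \<and> poly p3 \<zeta> = poly q \<zeta> * f3 \<zeta>"
    if "norm \<zeta> \<le> 1" for \<zeta>
  proof (intro conjI)
    show "poly p1 \<zeta> = poly q \<zeta> * f1 \<zeta>"
      by (rule ext[OF that cont(1)]) (use Pq in \<open>simp add: P_def\<close>)
    show "poly p2 \<zeta> = poly q \<zeta> * f2 \<zeta>"
      by (rule ext[OF that cont(2)]) (use Pq in \<open>simp add: P_def\<close>)
    show "poly p3 \<zeta> = poly q \<zeta> * f3 \<zeta>"
      by (rule ext[OF that cont(3)]) (use Pq in \<open>simp add: P_def\<close>)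
  qed
  show ?thesis
  proof (intro exI conjI allI impI)
    show "poly q \<zeta> \<noteq> 0" if "norm \<zeta> \<le> 1" for \<zeta>
      using main[OF that] nocommon[of \<zeta>] by auto
  qed (use main nocommon in blast)+
qed

text \<open>Let \<open>q\<close> be a reduced common denominator, with numerators \<open>p1\<close>, \<open>p2\<close>, \<open>p3\<close>. The boundary conditions
  become identities between these polynomials and their reflections. Those for \<open>p1\<close> and \<open>p2\<close> show
  that \<open>p3\<close> and \<open>q\<close> have no common root, and then \<open>|p3| = |q|\<close> on the circle forces the reflection of \<open>q\<close> to
  be \<open>c p3\<close> with \<open>|c| = 1\<close>. Multiplying everything by a square root \<open>s\<close> of \<open>c\<close> removes this constant,
  because the reflection of \<open>s q\<close> is \<open>cnj s * c * p3 = s p3\<close>.\<close>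

lemma tetra_representation_exists:
  assumes x: "x \<in> rational_tetra_inner"
  shows "\<exists>m E1 E2 D. tetra_representation x m E1 E2 D"
proof -
  let ?x1 = "comp1 x" and ?x2 = "comp2 x" and ?x3 = "comp3 x"
  have cx: "continuous_on (cball 0 1) x" using x by (simp add: rational_tetra_inner_def)
  have rat: "rational_analytic_on (ball 0 1) ?x1" "rational_analytic_on (ball 0 1) ?x2"
      "rational_analytic_on (ball 0 1) ?x3"
    using x by (auto simp: rational_tetra_inner_def)
  have cont: "continuous_on (cball 0 1) ?x1" "continuous_on (cball 0 1) ?x2"
      "continuous_on (cball 0 1) ?x3"
    by (intro continuous_intros cx)+
  obtain q p1 p2 p3 where
    quot: "\<forall>\<zeta>. norm \<zeta> \<le> 1 \<longrightarrow> poly q \<zeta> \<noteq> 0 \<and> poly p1 \<zeta> = poly q \<zeta> * ?x1 \<zeta> \<and>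
        poly p2 \<zeta> = poly q \<zeta> * ?x2 \<zeta> \<and> poly p3 \<zeta> = poly q \<zeta> * ?x3 \<zeta>" and
    nocommon: "\<forall>b. \<not> (poly q b = 0 \<and> poly p1 b = 0 \<and> poly p2 b = 0 \<and> poly p3 b = 0)"
    using reduced_common_denominator[OF rat cont] by (elim exE conjE)
  have q: "poly q \<zeta> \<noteq> 0" and
    p: "poly p1 \<zeta> = poly q \<zeta> * ?x1 \<zeta>" "poly p2 \<zeta> = poly q \<zeta> * ?x2 \<zeta>"
       "poly p3 \<zeta> = poly q \<zeta> * ?x3 \<zeta>" if "norm \<zeta> \<le> 1" for \<zeta>
    using quot that by auto
  have x1: "?x1 \<zeta> = cnj (?x2 \<zeta>) * ?x3 \<zeta>" and nx3: "norm (?x3 \<zeta>) = 1" if "norm \<zeta> = 1" for \<zeta>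
  proof -
    have "x \<zeta> \<in> tetrablock_boundary" using x that by (auto simp: rational_tetra_inner_def)
    then show "?x1 \<zeta> = cnj (?x2 \<zeta>) * ?x3 \<zeta>" "norm (?x3 \<zeta>) = 1"
      by (simp_all add: tetrablock_boundary_def split_beta)
  qed
  have x3: "?x3 \<zeta> * cnj (?x3 \<zeta>) = 1" if "norm \<zeta> = 1" for \<zeta>
    by (rule mult_cnj_circle[OF nx3[OF that]])
  have x2: "?x2 \<zeta> = cnj (?x1 \<zeta>) * ?x3 \<zeta>" if "norm \<zeta> = 1" for \<zeta>
    using x1[OF that] x3[OF that] by (simp add: mult_ac)

  \<comment> \<open>Any common bound \<open>M\<close> for the degrees serves for these two identities.\<close>
  define M where "M = Max {degree q, degree p1, degree p2, degree p3}"
  have M: "degree q \<le> M" "degree p1 \<le> M" "degree p2 \<le> M" by (auto simp: M_def)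
  have id1: "p1 * tilde_poly M q = tilde_poly M p2 * p3"
    by (rule poly_eq_on_circle) (simp add: poly_tilde_poly_circle M p x1 mult_ac)
  have id2: "p2 * tilde_poly M q = tilde_poly M p1 * p3"
    by (rule poly_eq_on_circle) (simp add: poly_tilde_poly_circle M p x2 mult_ac)
  \<comment> \<open>A zero of \<open>q\<close> lies outside the closed disc, while all zeros of its reflection lie inside.\<close>
  have cop: "poly q b \<noteq> 0" if b: "poly p3 b = 0" for b
  proof
    assume qb: "poly q b = 0"
    then have "\<not> norm b \<le> 1" using q by blast
    then have "poly (tilde_poly M q) b \<noteq> 0" using tilde_poly_root_in_disc[OF M(1) q] by fastforce
    moreover have "poly (p1 * tilde_poly M q) b = 0" "poly (p2 * tilde_poly M q) b = 0"
      by (simp_all add: id1 id2 b)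
    ultimately show False using nocommon qb b by auto
  qed

  \<comment> \<open>Here the reflection has to be taken with respect to the exact degree of \<open>p3/q\<close>: this leaves no room
    for a nonconstant cofactor \<open>u\<close>.\<close>
  define N where "N = max (degree q) (degree p3)"
  have N: "degree q \<le> N" "degree p3 \<le> N" by (auto simp: N_def)
  have id3: "p3 * tilde_poly N p3 = q * tilde_poly N q"
  proof (rule poly_eq_on_circle)
    fix \<zeta> :: complex assume z: "norm \<zeta> = 1"
    have "poly (p3 * tilde_poly N p3) \<zeta> =
        (?x3 \<zeta> * cnj (?x3 \<zeta>)) * (poly q \<zeta> * (\<zeta> ^ N * cnj (poly q \<zeta>)))"
      using z by (simp add: poly_tilde_poly_circle N p mult_ac)
    then show "poly (p3 * tilde_poly N p3) \<zeta> = poly (q * tilde_poly N q) \<zeta>"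
      using z by (simp add: poly_tilde_poly_circle N x3)
  qed
  have "?x3 1 \<noteq> 0" using x3[of 1] by fastforce
  then have "poly p3 1 \<noteq> 0" using p(3)[of 1] q[of 1] by simp
  then have p3_0: "p3 \<noteq> 0" by fastforce
  have q_0: "q \<noteq> 0" using q[of 1] by auto
  have "p3 dvd tilde_poly N q"
  proof (rule dvd_mult_left_if_no_common_root)
    show "p3 dvd q * tilde_poly N q" by (simp flip: id3)
  qed (rule cop)
  then obtain u where u: "tilde_poly N q = p3 * u" by (elim dvdE)
  have u': "tilde_poly N p3 = q * u" using id3 p3_0 unfolding u by (simp add: mult_ac)
  have u0: "u \<noteq> 0"
    using u tilde_poly_tilde_poly[OF N(1)] q_0 by (auto simp: tilde_poly_def)
  have "degree p3 + degree u \<le> N" "degree q + degree u \<le> N"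
    using degree_tilde_poly_le[of N q] degree_tilde_poly_le[of N p3] u u' u0 p3_0 q_0
    by (simp_all add: degree_mult_eq)
  then have "degree u = 0" unfolding N_def by linarith
  then obtain c where c: "u = [:c:]" by (elim degree_eq_zeroE)
  have qt: "tilde_poly N q = smult c p3" by (simp add: u c mult.commute)
  have "norm (poly (tilde_poly N q) 1) = norm (poly (smult c p3) 1)" by (simp add: qt)
  then have nc: "norm c = 1"
    using q[of 1] nx3[of 1] by (simp add: poly_tilde_poly_circle N p norm_mult)

  define s where "s = csqrt c"
  have s: "s * s = c" by (simp add: s_def flip: power2_eq_square)
  have ns: "norm s = 1" using nc by (simp add: s_def norm_csqrt)
  have s0: "s \<noteq> 0" using ns by auto
  define D where "D = smult s q"
  have D: "degree D \<le> N" "\<And>\<zeta>. norm \<zeta> \<le> 1 \<Longrightarrow> poly D \<zeta> \<noteq> 0"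
    using N q s0 by (auto simp: D_def)
  have Dt: "tilde_poly N D = smult s p3"
    using mult_cnj_circle[OF ns] by (simp add: D_def tilde_poly_smult qt flip: s mult.assoc)
       (simp add: mult.commute)
  have E: "poly (smult s p1) \<zeta> = poly D \<zeta> * ?x1 \<zeta>" "poly (smult s p2) \<zeta> = poly D \<zeta> * ?x2 \<zeta>"
    "poly (tilde_poly N D) \<zeta> = poly D \<zeta> * ?x3 \<zeta>" if "norm \<zeta> \<le> 1" for \<zeta>
    using p[OF that] unfolding Dt by (simp_all add: D_def)
  have E3: "\<zeta> ^ N * cnj (poly D \<zeta>) = poly D \<zeta> * ?x3 \<zeta>" if "norm \<zeta> = 1" for \<zeta>
    using E(3)[of \<zeta>] that D(1) by (simp add: poly_tilde_poly_circle)
  have "degree (smult s p2) \<le> N"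
  proof (rule degree_le_if_reflected_on_circle)
    fix \<zeta> :: complex assume z: "norm \<zeta> = 1"
    show "poly (smult s p1) \<zeta> = \<zeta> ^ N * cnj (poly (smult s p2) \<zeta>)"
      using E3[OF z] x1[OF z] E[of \<zeta>] z by (simp flip: mult.assoc) 
  qed
  moreover have "degree (smult s p1) \<le> N"
  proof (rule degree_le_if_reflected_on_circle)
    fix \<zeta> :: complex assume z: "norm \<zeta> = 1"
    show "poly (smult s p2) \<zeta> = \<zeta> ^ N * cnj (poly (smult s p1) \<zeta>)"
      using E3[OF z] x2[OF z] E[of \<zeta>] z by (simp flip: mult.assoc)
  qed
  moreover have "x \<zeta> = (poly (smult s p1) \<zeta> / poly D \<zeta>, poly (smult s p2) \<zeta> / poly D \<zeta>,
      poly (tilde_poly N D) \<zeta> / poly D \<zeta>)" if "norm \<zeta> \<le> 1" for \<zeta>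
    using E[OF that] D(2)[OF that] by (simp add: prod_eq_iff del: poly_smult)
  moreover from this have "has_inner_degree x N"
    unfolding has_inner_degree_def by (intro finite_Blaschke_product_tilde_quotient[OF D]) auto
  ultimately have "tetra_representation x N (smult s p1) (smult s p2) D"
    unfolding tetra_representation_def using D by auto
  then show ?thesis by blast
qed

section \<open>Counting royal nodes\<close>

lemma royal_poly_representation:
  assumes "x \<in> rational_tetra_inner"
  shows "\<exists>m E1 E2 D. tetra_representation x m E1 E2 D \<and>
    royal_poly x = tilde_poly m D * D - E1 * E2"
  unfolding royal_poly_def by (rule someI_ex) (use tetra_representation_exists[OF assms] in blast)

lemma sum_order_le_degree_subset:
  assumes "p \<noteq> 0" "finite A"
  shows "(\<Sum>a\<in>A. order a p) \<le> degree p"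
proof -
  have "(\<Sum>a\<in>A. order a p) = (\<Sum>a\<in>A \<inter> {a. poly p a = 0}. order a p)"
    using assms by (intro sum.mono_neutral_right) (auto simp: order_0I)
  also have "\<dots> \<le> (\<Sum>a | poly p a = 0. order a p)"
    using assms by (intro sum_mono2) (auto simp: poly_roots_finite)
  also have "\<dots> \<le> degree p" by (rule sum_order_le_degree[OF assms(1)])
  finally show ?thesis .
qed

lemma root_product_decomposition:
  fixes p :: "complex poly"
  assumes "p \<noteq> 0" "finite A"
  obtains h where "p = (\<Prod>a\<in>A. [:-a, 1:] ^ order a p) * h" "\<And>a. a \<in> A \<Longrightarrow> poly h a \<noteq> 0"
proof -
  have "\<exists>h. p = (\<Prod>a\<in>A. [:-a, 1:] ^ order a p) * h \<and> (\<forall>a\<in>A. poly h a \<noteq> 0)"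
    using assms(2)
  proof (induction A)
    case (insert a A)
    then obtain h where h: "p = (\<Prod>a\<in>A. [:-a, 1:] ^ order a p) * h" "\<forall>a\<in>A. poly h a \<noteq> 0" by auto
    let ?g = "\<Prod>a\<in>A. [:-a, 1:] ^ order a p"
    have h0: "h \<noteq> 0" "?g \<noteq> 0" using h(1) assms(1) by auto
    have "poly ?g a \<noteq> 0" using insert.hyps by (auto simp: poly_prod)
    then have "order a p = order a h"
      using h0 by (subst h(1)) (simp add: order_mult order_0I)
    with order_decomp[OF h0(1), of a] obtain h' where h': "h = [:-a, 1:] ^ order a p * h'"
        "\<not> [:-a, 1:] dvd h'" by auto
    have "poly h' a \<noteq> 0" using h'(2) by (simp add: poly_eq_0_iff_dvd)
    moreover have "\<forall>b\<in>A. poly h' b \<noteq> 0" using h(2) h'(1) by auto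
    moreover have "p = (\<Prod>a\<in>insert a A. [:-a, 1:] ^ order a p) * h'"
      using insert.hyps h(1) h'(1) by (simp add: mult_ac)
    ultimately show ?case by auto
  qed auto
  then show ?thesis using that by blast
qed

lemma degree_root_product:
  "degree (\<Prod>a\<in>A. [:-a, 1:] ^ n a :: complex poly) = (\<Sum>a\<in>A. n a)"
  by (subst degree_prod_sum_eq) (auto simp: degree_linear_power)

text \<open>Split \<open>R = G h\<close>, where \<open>G\<close> of degree \<open>d\<close> collects the zeros in \<open>A\<close>, and reflect both factors:
  \<open>R = G' h'\<close>. Since \<open>G\<close> has all its zeros in the closed disc, \<open>G'\<close> has none in the open disc. So \<open>h'\<close>, of degree
  at most \<open>2m - d\<close>, must account for all zeros of \<open>R\<close> in the open disc a second time. This counting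
  treats a zero at 0, whose mirror image is at infinity, like any other.\<close>

lemma self_reflected_root_count:
  assumes R: "R \<noteq> 0" "degree R \<le> 2 * m" "tilde_poly (2 * m) R = R"
    and A: "finite A" "\<And>a. a \<in> A \<Longrightarrow> norm a \<le> 1"
  shows "2 * (\<Sum>a\<in>A \<inter> ball 0 1. order a R) + (\<Sum>a\<in>A \<inter> sphere 0 1. order a R) \<le> 2 * m"
proof -
  define G where "G = (\<Prod>a\<in>A. [:-a, 1:] ^ order a R)"
  obtain h where h: "R = G * h" using root_product_decomposition[OF R(1) A(1)] unfolding G_def by blast
  define d where "d = (\<Sum>a\<in>A. order a R)"
  have nz: "G \<noteq> 0" "h \<noteq> 0" using R(1) unfolding h by auto
  have dG: "degree G = d" by (simp add: d_def G_def degree_root_product)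
  have "degree R = d + degree h" using nz dG by (subst h) (simp add: degree_mult_eq)
  then have d: "d \<le> 2 * m" "degree h \<le> 2 * m - d" using R(2) by auto
  define G' where "G' = tilde_poly d G"
  define h' where "h' = tilde_poly (2 * m - d) h"
  have R': "R = G' * h'"
  proof (rule poly_eq_on_circle)
    fix \<zeta> :: complex assume z: "norm \<zeta> = 1"
    have "poly R \<zeta> = \<zeta> ^ (2 * m) * cnj (poly R \<zeta>)"
      using poly_tilde_poly_circle[OF R(2) z] R(3) by simp
    also have "\<dots> = \<zeta> ^ d * \<zeta> ^ (2 * m - d) * cnj (poly G \<zeta> * poly h \<zeta>)"
      using d by (simp flip: power_add poly_mult h)
    also have "\<dots> = poly (G' * h') \<zeta>"
      using z d dG by (simp add: G'_def h'_def poly_tilde_poly_circle)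
    finally show "poly R \<zeta> = poly (G' * h') \<zeta>" .
  qed
  have nz': "G' \<noteq> 0" "h' \<noteq> 0" using R(1) unfolding R' by auto
  have "poly G' a \<noteq> 0" if a: "norm a < 1" for a
  proof (cases "a = 0")
    case True
    then show ?thesis using nz(1) dG by (auto simp: G'_def poly_tilde_poly_0)
  next
    case False
    have "1 < norm (1 / cnj a)" using a False by (simp add: norm_divide)
    then have "poly G (1 / cnj a) \<noteq> 0" using A by (force simp: G_def poly_prod)
    then show ?thesis using False dG by (simp add: G'_def poly_tilde_poly)
  qed
  then have "order a R = order a h'" if "a \<in> A \<inter> ball 0 1" for a
    using that nz' by (subst R') (simp add: order_mult order_0I)
  then have "(\<Sum>a\<in>A \<inter> ball 0 1. order a R) = (\<Sum>a\<in>A \<inter> ball 0 1. order a h')" by simp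
  also have "\<dots> \<le> degree h'" using nz' A by (intro sum_order_le_degree_subset) auto
  also have "\<dots> \<le> 2 * m - d" unfolding h'_def by (rule degree_tilde_poly_le)
  finally have "(\<Sum>a\<in>A \<inter> ball 0 1. order a R) + d \<le> 2 * m" using d by simp
  moreover have "d = (\<Sum>a\<in>A \<inter> ball 0 1. order a R) + (\<Sum>a\<in>A \<inter> sphere 0 1. order a R)"
    unfolding d_def using A
    by (subst sum.union_disjoint[symmetric]) (auto intro!: sum.cong simp: order_less_le)
  ultimately show ?thesis by simp
qed

section \<open>Perturbing the second component\<close>

theorem theorem1p3:
  fixes x :: "complex \<Rightarrow> complex3" and n k :: real
  assumes "x \<in> rational_tetra_inner"
    and "\<not> x ` cball 0 1 \<subseteq> royal_variety"
    and "n = (\<Sum>\<sigma>\<in>royal_nodes x. royal_multiplicity x \<sigma>)"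
    and "k = (\<Sum>\<sigma>\<in>royal_nodes x \<inter> sphere 0 1. royal_multiplicity x \<sigma>)"
    and "2 * k \<le> n"
  shows "\<not> extreme_point_on (ball 0 1) rational_tetra_inner x"
proof -
  obtain m E1 E2 D where rep: "tetra_representation x m E1 E2 D"
    and royal_eq: "royal_poly x = tilde_poly m D * D - E1 * E2"
    using royal_poly_representation[OF assms(1)] by (elim exE conjE)
  define R where "R = royal_poly x"
  have deg: "degree E1 \<le> m" "degree E2 \<le> m" "degree D \<le> m"
    and D: "\<And>\<zeta>. norm \<zeta> \<le> 1 \<Longrightarrow> poly D \<zeta> \<noteq> 0"
    and x: "\<And>\<zeta>. norm \<zeta> \<le> 1 \<Longrightarrow> x \<zeta> = (poly E1 \<zeta> / poly D \<zeta>, poly E2 \<zeta> / poly D \<zeta>,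
               poly (tilde_poly m D) \<zeta> / poly D \<zeta>)"
    using rep by (auto simp: tetra_representation_def)
  have R: "poly R \<zeta> = poly (tilde_poly m D) \<zeta> * poly D \<zeta> - poly E1 \<zeta> * poly E2 \<zeta>" for \<zeta>
    by (simp add: R_def royal_eq)
  have bd: "x \<zeta> \<in> tetrablock_boundary" if "norm \<zeta> = 1" for \<zeta>
    using assms(1) that by (auto simp: rational_tetra_inner_def)
  have E1: "E1 = tilde_poly m E2"
  proof (rule poly_eq_on_circle)
    fix \<zeta> :: complex assume z: "norm \<zeta> = 1"
    show "poly E1 \<zeta> = poly (tilde_poly m E2) \<zeta>"
      using bd[OF z] D[of \<zeta>] z deg
      by (simp add: x tetrablock_boundary_def poly_tilde_poly_circle field_simps)
  qed
  have E2: "norm (poly E2 \<zeta>) \<le> norm (poly D \<zeta>)" if z: "norm \<zeta> = 1" for \<zeta>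
    using bd[OF z] D[of \<zeta>] z by (simp add: x tetrablock_boundary_def norm_divide divide_le_eq)
  have Rc: "poly R \<zeta> = \<zeta> ^ m * of_real ((norm (poly D \<zeta>))\<^sup>2 - (norm (poly E2 \<zeta>))\<^sup>2)"
    if "norm \<zeta> = 1" for \<zeta>
    using that deg unfolding R E1 of_real_diff complex_norm_square
    by (simp add: poly_tilde_poly_circle algebra_simps)
  have degR: "degree R \<le> 2 * m"
    unfolding R_def royal_eq
    using deg degree_tilde_poly_le[of m D]
    by (intro degree_diff_le order.trans[OF degree_mult_le]) auto
  have tR: "tilde_poly (2 * m) R = R"
  proof (rule poly_eq_on_circle)
    fix \<zeta> :: complex assume z: "norm \<zeta> = 1"
    have "\<zeta> ^ (2 * m) * cnj (\<zeta> ^ m) = \<zeta> ^ m * (\<zeta> * cnj \<zeta>) ^ m"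
      by (simp add: mult_2 power_add power_mult_distrib)
    then show "poly (tilde_poly (2 * m) R) \<zeta> = poly R \<zeta>"
      using z degR by (simp add: poly_tilde_poly_circle Rc mult_cnj_circle flip: mult.assoc)
  qed
  have royal: "x \<zeta> \<in> royal_variety \<longleftrightarrow> poly R \<zeta> = 0" if "norm \<zeta> \<le> 1" for \<zeta>
    using D[OF that] by (auto simp: x[OF that] R royal_variety_def field_simps)
  have R0: "R \<noteq> 0" using assms(2) royal by auto
  have nodes: "royal_nodes x = {\<zeta>. norm \<zeta> \<le> 1 \<and> poly R \<zeta> = 0}"
    using royal by (auto simp: royal_nodes_def)
  have fin: "finite (royal_nodes x)"
    unfolding nodes using poly_roots_finite[OF R0] by (rule rev_finite_subset) auto

  let ?A = "royal_nodes x \<inter> sphere 0 1" and ?B = "royal_nodes x \<inter> ball 0 1"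
  define a where "a = (\<Sum>\<sigma>\<in>?B. order \<sigma> R)"
  define b where "b = (\<Sum>\<sigma>\<in>?A. order \<sigma> R)"
  have k: "k = real b / 2"
    unfolding assms(4) b_def
    by (simp add: royal_multiplicity_def sum_divide_distrib flip: R_def)
  have "n = (\<Sum>\<sigma>\<in>?B. royal_multiplicity x \<sigma>) + (\<Sum>\<sigma>\<in>?A. royal_multiplicity x \<sigma>)"
    unfolding assms(3) using fin
    by (subst sum.union_disjoint[symmetric])
       (auto simp: royal_nodes_def order_less_le intro!: sum.cong)
  then have n: "n = real a + k"
    unfolding assms(4) a_def by (simp add: royal_multiplicity_def flip: R_def)
  have "2 * a + b \<le> 2 * m"
    unfolding a_def b_def by (rule self_reflected_root_count[OF R0 degR tR fin]) (simp add: nodes)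
  with assms(5) n k have bm: "b \<le> m" by simp

  define g where "g = (\<Prod>\<sigma>\<in>?A. [:-\<sigma>, 1:] ^ order \<sigma> R)"
  have degg: "degree g \<le> m" using bm by (simp add: g_def degree_root_product b_def)
  obtain h where h: "R = g * h" "\<And>\<sigma>. \<sigma> \<in> ?A \<Longrightarrow> poly h \<sigma> \<noteq> 0"
    using root_product_decomposition[OF R0, of ?A] fin unfolding g_def by auto
  have h0: "poly h \<zeta> \<noteq> 0" if z: "norm \<zeta> = 1" for \<zeta>
  proof
    assume "poly h \<zeta> = 0"
    then have "\<zeta> \<in> ?A" using z h(1) by (simp add: nodes)
    with h(2) \<open>poly h \<zeta> = 0\<close> show False by blast
  qed
  have min: "\<exists>\<delta>>0. \<forall>\<zeta>\<in>sphere 0 1. \<delta> \<le> norm (poly h \<zeta>)"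
  proof -
    obtain \<xi> where "\<xi> \<in> sphere 0 1" "\<forall>\<zeta>\<in>sphere 0 1. norm (poly h \<xi>) \<le> norm (poly h \<zeta>)"
    proof -
      have "\<exists>\<xi>\<in>sphere 0 1. \<forall>\<zeta>\<in>sphere 0 1. norm (poly h \<xi>) \<le> norm (poly h \<zeta>)"
        by (rule continuous_attains_inf) (auto intro!: continuous_intros)
      then show ?thesis using that by blast
    qed
    then show ?thesis using h0[of \<xi>] by (intro exI[of _ "norm (poly h \<xi>)"]) auto
  qed
  have max: "\<exists>M\<ge>0. \<forall>\<zeta>\<in>sphere 0 1. norm (poly p \<zeta>) \<le> M" for p :: "complex poly"
  proof -
    have "bounded ((\<lambda>\<zeta>. poly p \<zeta>) ` sphere 0 1)"
      by (intro compact_imp_bounded compact_continuous_image continuous_intros) auto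
    then obtain M where "\<forall>\<zeta>\<in>sphere 0 1. norm (poly p \<zeta>) \<le> M" by (auto simp: bounded_iff)
    then show ?thesis by (intro exI[of _ "max M 0"]) auto
  qed
  from min obtain \<delta> where \<delta>: "\<delta> > 0" "\<And>\<zeta>. norm \<zeta> = 1 \<Longrightarrow> \<delta> \<le> norm (poly h \<zeta>)" by auto
  from max[of E2] obtain M where M: "M \<ge> 0" "\<And>\<zeta>. norm \<zeta> = 1 \<Longrightarrow> norm (poly E2 \<zeta>) \<le> M" by auto
  from max[of g] obtain M' where M': "M' \<ge> 0" "\<And>\<zeta>. norm \<zeta> = 1 \<Longrightarrow> norm (poly g \<zeta>) \<le> M'" by auto

  \<comment> \<open>The choice makes \<open>\<epsilon> (2 |E2| + \<epsilon> |g|)\<close> at most \<open>\<delta>\<close>, a lower bound of \<open>|h|\<close> on the circle; the summand 1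
    only keeps the denominator positive.\<close>
  define \<epsilon> where "\<epsilon> = min 1 (\<delta> / (2 * M + M' + 1))"
  have e: "0 < \<epsilon>" "\<epsilon> \<le> 1" "\<epsilon> * (2 * M + M') \<le> \<delta>"
  proof -
    show "0 < \<epsilon>" "\<epsilon> \<le> 1" using \<delta>(1) M(1) M'(1) by (auto simp: \<epsilon>_def)
    have "\<epsilon> * (2 * M + M') \<le> \<delta> / (2 * M + M' + 1) * (2 * M + M' + 1)"
      using \<delta>(1) M(1) M'(1) by (intro mult_mono) (auto simp: \<epsilon>_def)
    then show "\<epsilon> * (2 * M + M') \<le> \<delta>" using M(1) M'(1) by simp
  qed
  have dom: "norm (poly (E2 + smult c g) \<zeta>) \<le> norm (poly D \<zeta>)"
    if z: "norm \<zeta> = 1" and c: "norm c = \<epsilon>" for \<zeta> c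
  proof (rule power2_le_imp_le)
    let ?e = "norm (poly E2 \<zeta>)" and ?g = "norm (poly g \<zeta>)"
    have "norm (poly (E2 + smult c g) \<zeta>) \<le> ?e + \<epsilon> * ?g"
      using norm_triangle_ineq[of "poly E2 \<zeta>" "c * poly g \<zeta>"] by (simp add: norm_mult c)
    then have "(norm (poly (E2 + smult c g) \<zeta>))\<^sup>2 \<le> (?e + \<epsilon> * ?g)\<^sup>2"
      by (intro power_mono) auto
    also have "\<dots> = ?e\<^sup>2 + ?g * (\<epsilon> * (2 * ?e + \<epsilon> * ?g))"
      by (simp add: power2_eq_square algebra_simps)
    also have "\<dots> \<le> ?e\<^sup>2 + ?g * \<delta>"
    proof -
      have "\<epsilon> * ?g \<le> M'"
        using e M'(2)[OF z] mult_left_le_one_le[of ?g \<epsilon>] by simp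
      then have "\<epsilon> * (2 * ?e + \<epsilon> * ?g) \<le> \<epsilon> * (2 * M + M')"
        using M(2)[OF z] e(1) by (intro mult_left_mono) auto
      with e(3) show ?thesis by (intro add_left_mono mult_left_mono) auto
    qed
    also have "\<dots> \<le> ?e\<^sup>2 + ?g * norm (poly h \<zeta>)"
      using \<delta>(2)[OF z] by (intro add_left_mono mult_left_mono) auto
    also have "?g * norm (poly h \<zeta>) = norm (poly R \<zeta>)" by (simp add: h(1) norm_mult)
    also have "norm (poly R \<zeta>) = (norm (poly D \<zeta>))\<^sup>2 - ?e\<^sup>2"
    proof -
      have "?e\<^sup>2 \<le> (norm (poly D \<zeta>))\<^sup>2" using E2[OF z] by (intro power_mono) auto
      then show ?thesis using z by (simp only: Rc norm_mult norm_power norm_of_real) simp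
    qed
    finally show "(norm (poly (E2 + smult c g) \<zeta>))\<^sup>2 \<le> (norm (poly D \<zeta>))\<^sup>2" by simp
  qed simp

  define y where "y c = (\<lambda>\<zeta>. (poly (tilde_poly m (E2 + smult c g)) \<zeta> / poly D \<zeta>,
    poly (E2 + smult c g) \<zeta> / poly D \<zeta>, poly (tilde_poly m D) \<zeta> / poly D \<zeta>))" for c
  have y: "y c \<in> rational_tetra_inner" if "norm c = \<epsilon>" for c
    unfolding y_def using deg degg D dom that
    by (intro rational_tetra_inner_if_dominated degree_add_le order.trans[OF degree_smult_le]) auto
  have mid: "x \<zeta> = (1 / 2) *\<^sub>R y (of_real \<epsilon>) \<zeta> + (1 - 1 / 2) *\<^sub>R y (- of_real \<epsilon>) \<zeta>"
    if "\<zeta> \<in> ball 0 1" for \<zeta>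
    using that D[of \<zeta>]
    by (simp add: x y_def E1 tilde_poly_add tilde_poly_diff tilde_poly_smult scaleR_conv_of_real field_simps)
  \<comment> \<open>All zeros of \<open>g\<close> are on the circle, so the two functions already differ at 0.\<close>
  have g0: "poly g 0 \<noteq> 0" using fin by (auto simp: g_def poly_prod)
  then have ne: "y (of_real \<epsilon>) 0 \<noteq> y (- of_real \<epsilon>) 0"
    using e(1) D[of 0] by (auto simp: y_def)
  show ?thesis
  proof
    assume "extreme_point_on (ball 0 1) rational_tetra_inner x"
    then have "\<forall>u\<in>rational_tetra_inner. \<forall>v\<in>rational_tetra_inner. \<forall>t. 0 < t \<longrightarrow> t < 1 \<longrightarrow>
        (\<forall>\<zeta>\<in>ball 0 1. x \<zeta> = t *\<^sub>R u \<zeta> + (1 - t) *\<^sub>R v \<zeta>) \<longrightarrow> (\<forall>\<zeta>\<in>ball 0 1. u \<zeta> = v \<zeta>)"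
      by (simp add: extreme_point_on_def)
    moreover have "y (of_real \<epsilon>) \<in> rational_tetra_inner" "y (- of_real \<epsilon>) \<in> rational_tetra_inner"
      using e(1) by (auto intro!: y)
    ultimately have *: "0 < t \<longrightarrow> t < 1 \<longrightarrow>
        (\<forall>\<zeta>\<in>ball 0 1. x \<zeta> = t *\<^sub>R y (of_real \<epsilon>) \<zeta> + (1 - t) *\<^sub>R y (- of_real \<epsilon>) \<zeta>) \<longrightarrow>
        (\<forall>\<zeta>\<in>ball 0 1. y (of_real \<epsilon>) \<zeta> = y (- of_real \<epsilon>) \<zeta>)" for t
      by blast
    have "\<forall>\<zeta>\<in>ball 0 1. y (of_real \<epsilon>) \<zeta> = y (- of_real \<epsilon>) \<zeta>"
      using *[of "1/2"] mid by simp
    with ne show False by auto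
  qed
qed

end
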